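(* Suppose $(M_j)_{j=1}^\infty$, $(r_j)_{j=1}^\infty$ are strongly permissible, $c\in\mathbb{C}\setminus\{0\}$, and, with $c_j$ as defined in the context, $$r_{j+1}=c_jr_j^{M_j}\quad\text{for all } j\in\mathbb{N}.$$ Let $f$ be the entire function associated with $(M_j)$, $(r_j)$, $c$ (as described in the context). For $0<\alpha<1$ let $$A_j^\alpha:=\{z\in\mathbb{C}:\ \alpha^{-1}r_{j-1}\exp(\pi/M_{j-1})<|z|<\alpha r_j\}.$$ Then for any $0<\alpha<1$ there exists $N_\alpha$ such that, for all $j\ge N_\alpha$, $A_j^\alpha$ is contained in a multiply-connected wandering domain for $f$.
   Context: $\mathbb{N}=\{1,2,\dots\}$, $\mathbb{R}^+=(0,\infty)$. Sequences $(M_j)_{j\ge1}\subset\mathbb{N}$ and $(r_j)_{j\ge1}\subset\mathbb{R}^+$ are strongly permissible if $(M_j)$ is strictly increasing, $r_{j+1}\ge\exp(\pi/M_j)r_j$ for all $j$, $r_j\to\infty$, $\sup_jM_{j+1}/M_j<\infty$, and $\sum_jM_j^{-1}<\infty$. Put $r_0:=0$, $M_0:=1$, $c_1:=c$ and $c_j:=c_{j-1}r_{j-1}^{M_{j-1}-M_j}$ for $j\ge2$. The associated entire function: $f:\mathbb{C}\to\mathbb{C}$ is entire and there is a quasiconformal homeomorphism $\phi:\mathbb{C}\to\mathbb{C}$ with $\phi(0)=0$, $|\phi(z)/z-1|\to0$ as $z\to\infty$, and $f\circ\phi(z)=c_jz^{M_j}$ for $r_{j-1}\exp(\pi/M_{j-1})\le|z|\le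 r_j$ and all $j\in\mathbb{N}$; moreover all singular values of $f$ are critical values lying in $\{0\}\cup\{\pm c_jr_j^{M_j}:j\ge1\}$. (Such $f$ and $\phi$ exist for every strongly permissible choice of parameters and $c\ne0$.) A wandering domain of $f$ is a connected component $\Omega$ of the Fatou set of $f$ such that the Fatou components containing $f^n(\Omega)$, $n\ge0$, are pairwise distinct. *)

theory Defs
  imports "HOL-Complex_Analysis.Complex_Analysis"
begin

section \<open>Quasiconformal homeomorphisms of the plane\<close>

definition abs_continuous_on_interval :: "real \<Rightarrow> real \<Rightarrow> (real \<Rightarrow> complex) \<Rightarrow> bool" where
  "abs_continuous_on_interval a b g \<longleftrightarrow>
     (\<forall>\<epsilon>>0. \<exists>\<delta>>0. \<forall>P :: (real \<times> real) set.
        finite P \<longrightarrow> (\<forall>(s, t)\<in>P. a \<le> s \<and> s \<le> t \<and> t \<le> b) \<longrightarrow>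
        disjoint_family_on (\<lambda>(s, t). {s<..<t}) P \<longrightarrow>
        (\<Sum>(s, t)\<in>P. t - s) < \<delta> \<longrightarrow> (\<Sum>(s, t)\<in>P. dist (g s) (g t)) < \<epsilon>)"

definition ACL :: "(complex \<Rightarrow> complex) \<Rightarrow> bool" where
  "ACL \<phi> \<longleftrightarrow>
     (\<forall>a b. (AE y in lebesgue. abs_continuous_on_interval a b (\<lambda>x. \<phi> (Complex x y))) \<and>
            (AE x in lebesgue. abs_continuous_on_interval a b (\<lambda>y. \<phi> (Complex x y))))"

text \<open>
  The analytic definition: an ACL homeomorphism of the plane whose complex derivatives
  satisfy \<open>\<bar>\<phi>\<^sub>z\<^sub>b\<^sub>a\<^sub>r\<bar> \<le> k \<bar>\<phi>\<^sub>z\<bar>\<close> almost everywhere for some \<open>k < 1\<close>, where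
  \<open>\<phi>\<^sub>z = (\<phi>\<^sub>x - i \<phi>\<^sub>y) / 2\<close> and \<open>\<phi>\<^sub>z\<^sub>b\<^sub>a\<^sub>r = (\<phi>\<^sub>x + i \<phi>\<^sub>y) / 2\<close>. As \<open>k < 1\<close>, such maps
  preserve orientation.
\<close>
definition quasiconformal :: "(complex \<Rightarrow> complex) \<Rightarrow> bool" where
  "quasiconformal \<phi> \<longleftrightarrow>
     (\<exists>\<psi>. homeomorphism UNIV UNIV \<phi> \<psi>) \<and> ACL \<phi> \<and>
     (\<exists>k. 0 \<le> k \<and> k < 1 \<and>
        (AE z in lebesgue. \<exists>\<phi>x \<phi>y.
           ((\<lambda>x. \<phi> (Complex x (Im z))) has_vector_derivative \<phi>x) (at (Re z)) \<and>
           ((\<lambda>y. \<phi> (Complex (Re z) y)) has_vector_derivative \<phi>y) (at (Im z)) \<and>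
           cmod ((\<phi>x + \<i> * \<phi>y) / 2) \<le> k * cmod ((\<phi>x - \<i> * \<phi>y) / 2)))"

section \<open>Singular values\<close>

definition critical_values :: "(complex \<Rightarrow> complex) \<Rightarrow> complex set" where
  "critical_values f = {f z | z. deriv f z = 0}"

definition asymptotic_values :: "(complex \<Rightarrow> complex) \<Rightarrow> complex set" where
  "asymptotic_values f = {a. \<exists>\<gamma> :: real \<Rightarrow> complex. continuous_on {0..} \<gamma> \<and>
     filterlim \<gamma> at_infinity at_top \<and> ((\<lambda>t. f (\<gamma> t)) \<longlongrightarrow> a) at_top}"

definition singular_values :: "(complex \<Rightarrow> complex) \<Rightarrow> complex set" where
  "singular_values f = closure (critical_values f \<union> asymptotic_values f)"

section \<open>Fatou set and wandering domains of an entire function\<close>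

text \<open>
  Normality with respect to the spherical metric, for holomorphic functions on a domain
  (an open connected set): a locally uniform limit in the sphere is then either finite
  throughout or identically infinite.
\<close>
definition normal_family_on :: "complex set \<Rightarrow> (complex \<Rightarrow> complex) set \<Rightarrow> bool" where
  "normal_family_on U \<F> \<longleftrightarrow>
     (\<forall>h :: nat \<Rightarrow> complex \<Rightarrow> complex. range h \<subseteq> \<F> \<longrightarrow>
        (\<exists>s :: nat \<Rightarrow> nat. strict_mono s \<and>
           ((\<exists>g. \<forall>K. compact K \<and> K \<subseteq> U \<longrightarrow> uniform_limit K (\<lambda>n. h (s n)) g sequentially) \<or>
            (\<forall>K. compact K \<and> K \<subseteq> U \<longrightarrow>
               (\<forall>B. \<forall>\<^sub>F n in sequentially. \<forall>z\<in>K. cmod (h (s n) z) > B)))))"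

definition Fatou_set :: "(complex \<Rightarrow> complex) \<Rightarrow> complex set" where
  "Fatou_set f =
     {z. \<exists>U. open U \<and> connected U \<and> z \<in> U \<and> normal_family_on U (range (\<lambda>n. f ^^ n))}"

definition wandering_domain :: "(complex \<Rightarrow> complex) \<Rightarrow> complex set \<Rightarrow> bool" where
  "wandering_domain f \<Omega> \<longleftrightarrow> \<Omega> \<in> components (Fatou_set f) \<and>
     (\<exists>U :: nat \<Rightarrow> complex set.
        (\<forall>n. U n \<in> components (Fatou_set f) \<and> (f ^^ n) ` \<Omega> \<subseteq> U n) \<and> inj U)"

section \<open>Interpolation of power maps\<close>

text \<open>
  Sequences are indexed by \<open>j \<ge> 1\<close>; the entries \<open>M 0\<close> and \<open>r 0\<close> carry the conventions
  \<open>M\<^sub>0 = 1\<close> and \<open>r\<^sub>0 = 0\<close>, which are not part of the notion of permissibility.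
\<close>
definition strongly_permissible :: "(nat \<Rightarrow> nat) \<Rightarrow> (nat \<Rightarrow> real) \<Rightarrow> bool" where
  "strongly_permissible M r \<longleftrightarrow>
     (\<forall>j\<ge>1. M j \<ge> 1) \<and> (\<forall>j\<ge>1. r j > 0) \<and>
     strict_mono_on {1..} M \<and>
     (\<forall>j\<ge>1. r (j + 1) \<ge> exp (pi / real (M j)) * r j) \<and>
     filterlim r at_top sequentially \<and>
     bdd_above ((\<lambda>j. real (M (j + 1)) / real (M j)) ` {1..}) \<and>
     summable (\<lambda>j. 1 / real (M (j + 1)))"

text \<open>The value at index \<open>0\<close> is irrelevant.\<close>
fun power_coeff :: "(nat \<Rightarrow> nat) \<Rightarrow> (nat \<Rightarrow> real) \<Rightarrow> complex \<Rightarrow> nat \<Rightarrow> complex" where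
  "power_coeff M r c 0 = 0"
| "power_coeff M r c (Suc 0) = c"
| "power_coeff M r c (Suc (Suc j)) =
     power_coeff M r c (Suc j) *
       complex_of_real (r (Suc j)) powi (int (M (Suc j)) - int (M (Suc (Suc j))))"

definition associated_entire_function ::
    "(nat \<Rightarrow> nat) \<Rightarrow> (nat \<Rightarrow> real) \<Rightarrow> complex \<Rightarrow> (complex \<Rightarrow> complex) \<Rightarrow> bool" where
  "associated_entire_function M r c f \<longleftrightarrow>
     f holomorphic_on UNIV \<and>
     (\<exists>\<phi>. quasiconformal \<phi> \<and> \<phi> 0 = 0 \<and>
        ((\<lambda>z. cmod (\<phi> z / z - 1)) \<longlongrightarrow> 0) at_infinity \<and>
        (\<forall>j\<ge>1. \<forall>z. r (j - 1) * exp (pi / real (M (j - 1))) \<le> cmod z \<and> cmod z \<le> r j \<longrightarrow>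
           f (\<phi> z) = power_coeff M r c j * z ^ M j)) \<and>
     singular_values f \<subseteq> critical_values f \<and>
     singular_values f \<subseteq> {0} \<union>
       {w. \<exists>j\<ge>1. w = power_coeff M r c j * complex_of_real (r j) ^ M j \<or>
                 w = - (power_coeff M r c j * complex_of_real (r j) ^ M j)}"

definition annulus :: "(nat \<Rightarrow> nat) \<Rightarrow> (nat \<Rightarrow> real) \<Rightarrow> real \<Rightarrow> nat \<Rightarrow> complex set" where
  "annulus M r \<alpha> j =
     {z. inverse \<alpha> * r (j - 1) * exp (pi / real (M (j - 1))) < cmod z \<and> cmod z < \<alpha> * r j}"

end

theory Submission
  imports Defs
begin

text \<open>
  Since \<open>\<phi> z \<sim> z\<close>, the map \<open>f\<close> acts on the annuli like \<open>c\<^sub>j z ^ M\<^sub>j\<close>, and the relation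
  \<open>r\<^sub>j\<^sub>+\<^sub>1 = c\<^sub>j r\<^sub>j ^ M\<^sub>j\<close> makes it send \<open>A\<^sub>j\<close> into \<open>A\<^sub>j\<^sub>+\<^sub>1\<close> for large \<open>j\<close>. So the iterates tend
  to infinity uniformly on \<open>A\<^sub>j\<close>, hence locally uniformly on the Fatou component containing it.
  This component omits the fixed point \<open>0\<close>, which \<open>A\<^sub>j\<close> surrounds, so it is multiply connected.
  By Harnack's inequality for the eventually positive functions \<open>ln \<bar>f\<^sup>n\<bar>\<close>, orbits of two points of
  one such component satisfy \<open>ln \<bar>f\<^sup>n z\<bar> = O(ln \<bar>f\<^sup>n w\<bar>)\<close>. For \<open>w\<close> in \<open>A\<^sub>j\<close> and \<open>z\<close> in \<open>A\<^sub>k\<close>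
  with \<open>j < k\<close> the quotient is at least of the order of \<open>M\<^sub>j\<^sub>+\<^sub>n\<close>, which is unbounded. So distinct
  annuli lie in distinct components.
\<close>

subsection \<open>Points with locally uniform escape\<close>

definition uniformly_escaping :: "(complex \<Rightarrow> complex) \<Rightarrow> complex set \<Rightarrow> bool" where
  "uniformly_escaping f K \<longleftrightarrow> (\<forall>B. \<forall>\<^sub>F n in sequentially. \<forall>z\<in>K. cmod ((f ^^ n) z) > B)"

lemma uniformly_escaping_subset:
  "uniformly_escaping f K \<Longrightarrow> L \<subseteq> K \<Longrightarrow> uniformly_escaping f L"
  unfolding uniformly_escaping_def by (fast elim: eventually_mono)

text \<open>Escape is demanded uniformly on open sets, so the set is open by construction; it turns
  out to be a union of Fatou components.\<close>

definition locally_escaping_set :: "(complex \<Rightarrow> complex) \<Rightarrow> complex set" where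
  "locally_escaping_set f = \<Union> {V. open V \<and> uniformly_escaping f V}"

lemma open_locally_escaping_set: "open (locally_escaping_set f)"
  unfolding locally_escaping_set_def by auto

text \<open>A sequence of iterates either repeats one exponent infinitely often, which gives a
  constant subsequence, or its exponents tend to infinity, and then the whole sequence
  escapes.\<close>

lemma normal_family_on_if_uniformly_escaping:
  assumes "uniformly_escaping f U"
  shows "normal_family_on U (range (\<lambda>n. f ^^ n))"
  unfolding normal_family_on_def
proof (intro allI impI)
  fix h :: "nat \<Rightarrow> complex \<Rightarrow> complex"
  assume "range h \<subseteq> range (\<lambda>n. f ^^ n)"
  then have "\<forall>i. \<exists>k. h i = f ^^ k" by blast
  then obtain k where k: "\<And>i. h i = f ^^ k i" by metis
  show "\<exists>s :: nat \<Rightarrow> nat. strict_mono s \<and>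
      ((\<exists>g. \<forall>K. compact K \<and> K \<subseteq> U \<longrightarrow> uniform_limit K (\<lambda>n. h (s n)) g sequentially) \<or>
       (\<forall>K. compact K \<and> K \<subseteq> U \<longrightarrow> (\<forall>B. \<forall>\<^sub>F n in sequentially. \<forall>z\<in>K. cmod (h (s n) z) > B)))"
  proof (cases "\<exists>m. infinite {i. k i = m}")
    case True
    then obtain m where m: "infinite {i. k i = m}" by blast
    obtain s :: "nat \<Rightarrow> nat" where s: "strict_mono s" "\<And>n. k (s n) = m"
      using infinite_enumerate[OF m] by auto
    have "uniform_limit K (\<lambda>n. h (s n)) (f ^^ m) sequentially" for K
      by (simp add: k s uniform_limit_const)
    then show ?thesis using s(1) by blast
  next
    case False
    then have fin: "finite {i. k i = m}" for m by blast
    have k_top: "filterlim k at_top sequentially"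
    proof (unfold filterlim_at_top, rule allI)
      fix m
      have "finite (\<Union>l<m. {i. k i = l})" using fin by blast
      moreover have "{i. \<not> m \<le> k i} \<subseteq> (\<Union>l<m. {i. k i = l})" by auto
      ultimately have "finite {i. \<not> m \<le> k i}" by (rule rev_finite_subset)
      then show "\<forall>\<^sub>F i in sequentially. m \<le> k i"
        by (simp add: cofinite_eq_sequentially[symmetric] eventually_cofinite)
    qed
    have "\<forall>\<^sub>F n in sequentially. \<forall>z\<in>K. cmod (h (id n) z) > B" if "K \<subseteq> U" for K B
    proof -
      have "\<forall>\<^sub>F n in sequentially. \<forall>z\<in>K. cmod ((f ^^ n) z) > B"
        using uniformly_escaping_subset[OF assms that] by (simp add: uniformly_escaping_def)
      from eventually_compose_filterlim[OF this k_top] show ?thesis by (simp add: k)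
    qed
    then show ?thesis using strict_mono_id by blast
  qed
qed

lemma locally_escaping_setE_ball:
  assumes "z \<in> locally_escaping_set f"
  obtains d where "d > 0" "uniformly_escaping f (ball z d)"
proof -
  obtain V where V: "open V" "uniformly_escaping f V" "z \<in> V"
    using assms by (auto simp: locally_escaping_set_def)
  then obtain d where "d > 0" "ball z d \<subseteq> V" using openE by blast
  with V(2) that uniformly_escaping_subset show thesis by blast
qed

lemma locally_escaping_set_subset_Fatou_set: "locally_escaping_set f \<subseteq> Fatou_set f"
proof
  fix z assume "z \<in> locally_escaping_set f"
  then obtain d where "d > 0" "uniformly_escaping f (ball z d)"
    by (rule locally_escaping_setE_ball)
  then show "z \<in> Fatou_set f"
    unfolding Fatou_set_def
    by (auto intro!: exI[of _ "ball z d"] normal_family_on_if_uniformly_escaping)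
qed

lemma eventually_norm_gt_if_escaping:
  assumes "x \<in> locally_escaping_set f"
  shows "\<forall>\<^sub>F n in sequentially. cmod ((f ^^ n) x) > B"
proof -
  obtain d where d: "d > 0" "uniformly_escaping f (ball x d)"
    using assms by (rule locally_escaping_setE_ball)
  from d(2) have "\<forall>\<^sub>F n in sequentially. \<forall>z\<in>ball x d. cmod ((f ^^ n) z) > B"
    unfolding uniformly_escaping_def by blast
  then show ?thesis by eventually_elim (use d(1) in auto)
qed

section \<open>Spreading of escape over Fatou components\<close>

lemma open_Fatou_set: "open (Fatou_set f)"
proof (subst open_subopen, rule ballI)
  fix z assume "z \<in> Fatou_set f"
  then obtain U where "open U" "connected U" "z \<in> U" "normal_family_on U (range (\<lambda>n. f ^^ n))"
    by (auto simp: Fatou_set_def)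
  then show "\<exists>T. open T \<and> z \<in> T \<and> T \<subseteq> Fatou_set f"
    by (auto simp: Fatou_set_def intro!: exI[of _ U])
qed

text \<open>By normality, escape at one point of \<open>U\<close> excludes finite limit functions on \<open>U\<close>.\<close>
lemma uniformly_escaping_if_normal:
  assumes normal: "normal_family_on U (range (\<lambda>n. f ^^ n))"
    and x: "x \<in> U" "x \<in> locally_escaping_set f" and K: "compact K" "K \<subseteq> U"
  shows "uniformly_escaping f K"
  unfolding uniformly_escaping_def
proof (rule allI, rule ccontr)
  fix B
  assume "\<not> (\<forall>\<^sub>F n in sequentially. \<forall>z\<in>K. B < cmod ((f ^^ n) z))"
  then have inf: "infinite {n. \<not> (\<forall>z\<in>K. B < cmod ((f ^^ n) z))}"
    by (simp add: cofinite_eq_sequentially[symmetric] eventually_cofinite)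
  obtain s0 :: "nat \<Rightarrow> nat" where s0: "strict_mono s0"
    "\<And>n. \<not> (\<forall>z\<in>K. B < cmod ((f ^^ s0 n) z))"
    using infinite_enumerate[OF inf] by blast
  have "range (\<lambda>i. f ^^ s0 i) \<subseteq> range (\<lambda>n. f ^^ n)" by blast
  then obtain s :: "nat \<Rightarrow> nat" where s: "strict_mono s"
    and alt: "(\<exists>g. \<forall>K. compact K \<and> K \<subseteq> U \<longrightarrow> uniform_limit K (\<lambda>n. f ^^ s0 (s n)) g sequentially) \<or>
       (\<forall>K. compact K \<and> K \<subseteq> U \<longrightarrow> (\<forall>B. \<forall>\<^sub>F n in sequentially. \<forall>z\<in>K. cmod ((f ^^ s0 (s n)) z) > B))"
    using normal unfolding normal_family_on_def by blast
  from alt show False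
  proof
    assume "\<exists>g. \<forall>K. compact K \<and> K \<subseteq> U \<longrightarrow> uniform_limit K (\<lambda>n. f ^^ s0 (s n)) g sequentially"
    then obtain g where "uniform_limit {x} (\<lambda>n. f ^^ s0 (s n)) g sequentially"
      using x(1) by (meson compact_sing empty_subsetI insert_subset)
    then have "(\<lambda>n. (f ^^ s0 (s n)) x) \<longlonglongrightarrow> g x" by simp
    then have "Bseq (\<lambda>n. (f ^^ s0 (s n)) x)"
      by (meson Bseq_eq_bounded convergent_imp_bounded)
    then obtain C where C: "\<And>n. cmod ((f ^^ s0 (s n)) x) \<le> C" by (auto simp: Bseq_def)
    have "filterlim (\<lambda>n. s0 (s n)) at_top sequentially"
      using filterlim_compose filterlim_subseq s(1) s0(1) by blast
    from eventually_compose_filterlim[OF eventually_norm_gt_if_escaping[OF x(2), of C] this]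
    have "\<forall>\<^sub>F n in sequentially. False"
      by eventually_elim (use C in \<open>simp add: not_less[symmetric]\<close>)
    then show False by simp
  next
    assume "\<forall>K. compact K \<and> K \<subseteq> U \<longrightarrow>
      (\<forall>B. \<forall>\<^sub>F n in sequentially. \<forall>z\<in>K. cmod ((f ^^ s0 (s n)) z) > B)"
    then have "\<forall>\<^sub>F n in sequentially. \<forall>z\<in>K. cmod ((f ^^ s0 (s n)) z) > B" using K by blast
    then have "\<forall>\<^sub>F n in sequentially. False" by eventually_elim (use s0(2) in blast)
    then show False by simp
  qed
qed

text \<open>The escaping part of \<open>\<Omega>\<close> is relatively clopen. For closedness, a
  normal neighbourhood of a limit point contains an escaping point, so a closed disc about the limit
  point escapes uniformly; a closed disc is taken because normality controls compact sets
  only.\<close>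

lemma Fatou_component_subset_locally_escaping_set:
  assumes \<Omega>: "\<Omega> \<in> components (Fatou_set f)" and x: "x \<in> \<Omega>" "x \<in> locally_escaping_set f"
  shows "\<Omega> \<subseteq> locally_escaping_set f"
proof -
  let ?E = "locally_escaping_set f"
  have "connected \<Omega>" using \<Omega> by (rule in_components_connected)
  moreover have "openin (top_of_set \<Omega>) (\<Omega> \<inter> ?E)"
    by (simp add: open_locally_escaping_set openin_open_Int)
  moreover have "closedin (top_of_set \<Omega>) (\<Omega> \<inter> ?E)"
  proof -
    have "z \<in> ?E" if z: "z \<in> \<Omega>" "z \<in> closure ?E" for z
    proof -
      have "z \<in> Fatou_set f" using z(1) \<Omega> in_components_subset by blast
      then obtain U where U: "open U" "z \<in> U" "normal_family_on U (range (\<lambda>n. f ^^ n))"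
        by (auto simp: Fatou_set_def)
      then obtain y where y: "y \<in> U" "y \<in> ?E"
        using z(2) by (auto simp: closure_iff_nhds_not_empty)
      obtain d where d: "d > 0" "cball z d \<subseteq> U" using U(1,2) open_contains_cball by blast
      have "uniformly_escaping f (cball z d)"
        using uniformly_escaping_if_normal[OF U(3) y compact_cball d(2)] .
      then have "uniformly_escaping f (ball z d)" by (rule uniformly_escaping_subset) auto
      then show ?thesis using d(1) by (auto simp: locally_escaping_set_def intro!: exI[of _ "ball z d"])
    qed
    then have "\<Omega> \<inter> ?E = \<Omega> \<inter> closure ?E" using closure_subset[of ?E] by blast
    then show ?thesis by (simp add: closedin_closed_Int)
  qed
  ultimately have "\<Omega> \<inter> ?E = {} \<or> \<Omega> \<inter> ?E = \<Omega>" by (simp add: connected_clopen)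
  with x show ?thesis by blast
qed

lemma image_locally_escaping_set:
  assumes hol: "f holomorphic_on UNIV"
  shows "f ` locally_escaping_set f \<subseteq> locally_escaping_set f"
proof (rule image_subsetI)
  fix z assume z: "z \<in> locally_escaping_set f"
  then obtain d where d: "d > 0" "uniformly_escaping f (ball z d)"
    by (rule locally_escaping_setE_ball)
  \<comment> \<open>A constant map has bounded orbits, contrary to the escape of \<open>z\<close>;
    the open mapping theorem needs this.\<close>
  have "\<not> f constant_on UNIV"
  proof
    assume "f constant_on UNIV"
    then obtain b where b: "\<And>w. f w = b" by (auto simp: constant_on_def)
    have "(f ^^ Suc n) z = b" for n by (simp add: b)
    moreover have "\<forall>\<^sub>F n in sequentially. cmod ((f ^^ Suc n) z) > cmod b"
      using eventually_norm_gt_if_escaping[OF z] by (subst eventually_sequentially_Suc)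
    ultimately show False by (simp add: b)
  qed
  then have "open (f ` ball z d)" by (intro open_mapping_thm[OF hol]) auto
  moreover have "uniformly_escaping f (f ` ball z d)"
    unfolding uniformly_escaping_def
  proof
    fix B
    have "\<forall>\<^sub>F n in sequentially. \<forall>w\<in>ball z d. cmod ((f ^^ Suc n) w) > B"
      using d(2) unfolding uniformly_escaping_def by (subst eventually_sequentially_Suc) blast
    then show "\<forall>\<^sub>F n in sequentially. \<forall>w\<in>f ` ball z d. B < cmod ((f ^^ n) w)"
      by (simp add: funpow_Suc_right del: funpow.simps)
  qed
  moreover have "f z \<in> f ` ball z d" using d(1) by simp
  ultimately show "f z \<in> locally_escaping_set f" unfolding locally_escaping_set_def by blast
qed

subsection \<open>Comparable growth of orbits in a Fatou component\<close>

lemma holomorphic_on_funpow: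
  "f holomorphic_on UNIV \<Longrightarrow> (f ^^ n) holomorphic_on UNIV" for f :: "complex \<Rightarrow> complex"
proof (induction n)
  case (Suc n)
  then have "f \<circ> (f ^^ n) holomorphic_on UNIV"
    by (intro holomorphic_on_compose_gen[where t = UNIV]) simp_all
  then show ?case by (simp only: funpow.simps)
qed (simp add: id_def)

text \<open>Schwarz's lemma for \<open>(g - g w) / (g + cnj (g w))\<close>, where \<open>g\<close> is a logarithm of \<open>F\<close>.\<close>
lemma Harnack_ln_norm:
  assumes hol: "F holomorphic_on ball w \<rho>" and gt: "\<And>z. z \<in> ball w \<rho> \<Longrightarrow> cmod (F z) > 1"
    and z: "dist w z \<le> \<rho> / 2" and \<rho>: "\<rho> > 0"
  shows "ln (cmod (F z)) \<le> 3 * ln (cmod (F w))"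
proof -
  have "F x \<noteq> 0" if "x \<in> ball w \<rho>" for x using gt[OF that] by auto
  then obtain g where g: "g holomorphic_on ball w \<rho>" "\<And>x. x \<in> ball w \<rho> \<Longrightarrow> exp (g x) = F x"
    using holomorphic_logarithm_exists[OF convex_ball open_ball hol, of w] \<rho> by auto
  have ln_eq: "ln (cmod (F x)) = Re (g x)" if "x \<in> ball w \<rho>" for x
    using g(2)[OF that, symmetric] by simp
  have pos: "Re (g x) > 0" if "x \<in> ball w \<rho>" for x
    using gt[OF that] ln_eq[OF that] ln_gt_zero by metis
  define b where "b = g w"
  have b: "Re b > 0" unfolding b_def using pos \<rho> by simp
  \<comment> \<open>Rescaling to the unit disc centred at 0, where Schwarz's lemma is
    stated.\<close>
  define S where "S = (\<lambda>u. w + of_real \<rho> * u)"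
  have S: "S u \<in> ball w \<rho>" if "cmod u < 1" for u
    using that \<rho> by (simp add: S_def dist_norm norm_mult)
  define H where "H = (\<lambda>u. (g (S u) - b) / (g (S u) + cnj b))"
  have nz: "g (S u) + cnj b \<noteq> 0" if "cmod u < 1" for u
    using pos[OF S[OF that]] b by (auto simp: complex_eq_iff)
  have "(g \<circ> S) holomorphic_on ball 0 1"
    by (rule holomorphic_on_compose_gen[OF _ g(1)])
       (use S in \<open>auto simp: S_def intro!: holomorphic_intros\<close>)
  then have "H holomorphic_on ball 0 1"
    unfolding H_def o_def using nz by (intro holomorphic_intros) auto
  moreover have "H 0 = 0" by (simp add: H_def S_def b_def)
  moreover have "cmod (H u) < 1" if "cmod u < 1" for u
  proof -
    have p: "Re (g (S u)) > 0" using pos S that by blast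
    \<comment> \<open>The two squares differ by \<open>4 * Re (g (S u)) * Re b\<close>, which is
      positive.\<close>
    have "(cmod (g (S u) - b))\<^sup>2 < (cmod (g (S u) + cnj b))\<^sup>2"
      using mult_pos_pos[OF p b] unfolding cmod_power2
      by (simp add: power2_eq_square algebra_simps)
    then have "cmod (g (S u) - b) < cmod (g (S u) + cnj b)"
      by (rule power2_less_imp_less) simp
    then show ?thesis using nz[OF that] by (simp add: H_def norm_divide)
  qed
  moreover define u where "u = (z - w) / of_real \<rho>"
  moreover have u: "cmod u \<le> 1 / 2"
    using z \<rho> by (simp add: u_def norm_divide dist_norm norm_minus_commute field_simps)
  ultimately have "cmod (H u) \<le> cmod u" using Schwarz_Lemma(1)[of H u] by auto
  moreover have Su: "S u = z" using \<rho> by (simp add: S_def u_def)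
  ultimately have "cmod (H u) \<le> 1 / 2" using u by linarith
  \<comment> \<open>The constant 3 arises here: with \<open>d = g z - b\<close>, the bound
    \<open>2 * cmod d \<le> cmod d + 2 * Re b\<close> gives
    \<open>cmod d \<le> 2 * Re b\<close>.\<close>
  then have "cmod (g z - b) * 2 \<le> cmod (g z + cnj b)"
    using nz[of u] u by (simp add: H_def norm_divide Su field_simps)
  moreover define d where "d = g z - b"
  then have "g z + cnj b = d + of_real (2 * Re b)" by (simp add: complex_eq_iff)
  then have "cmod (g z + cnj b) \<le> cmod d + 2 * Re b"
    using norm_triangle_ineq[of d "of_real (2 * Re b)"] b by simp
  ultimately have "cmod d \<le> 2 * Re b" by (simp add: d_def)
  then have "Re (g z) \<le> 3 * Re b"
    using complex_Re_le_cmod[of d] by (simp add: d_def)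
  moreover have "z \<in> ball w \<rho>" using z \<rho> by simp
  ultimately show ?thesis using ln_eq[of z] ln_eq[of w] \<rho> by (simp add: b_def)
qed

definition dominated_orbit :: "(complex \<Rightarrow> complex) \<Rightarrow> complex \<Rightarrow> complex \<Rightarrow> bool" where
  "dominated_orbit f z w \<longleftrightarrow> (\<exists>C>0. \<forall>\<^sub>F n in sequentially.
     ln (cmod ((f ^^ n) z)) \<le> C * ln (cmod ((f ^^ n) w)))"

lemma dominated_orbit_trans:
  assumes "dominated_orbit f x y" "dominated_orbit f y z"
  shows "dominated_orbit f x z"
proof -
  obtain C D where C: "C > 0" "\<forall>\<^sub>F n in sequentially. ln (cmod ((f ^^ n) x)) \<le> C * ln (cmod ((f ^^ n) y))"
    and D: "D > 0" "\<forall>\<^sub>F n in sequentially. ln (cmod ((f ^^ n) y)) \<le> D * ln (cmod ((f ^^ n) z))"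
    using assms unfolding dominated_orbit_def by blast
  from C(2) D(2) have "\<forall>\<^sub>F n in sequentially. ln (cmod ((f ^^ n) x)) \<le> (C * D) * ln (cmod ((f ^^ n) z))"
  proof eventually_elim
    case (elim n)
    then have "C * ln (cmod ((f ^^ n) y)) \<le> C * (D * ln (cmod ((f ^^ n) z)))"
      using C(1) by simp
    with elim show ?case by (simp add: mult.assoc)
  qed
  then show ?thesis unfolding dominated_orbit_def using C(1) D(1) by (meson mult_pos_pos)
qed

text \<open>The Harnack constant 3 does not depend on the iterate, so it serves as soon as the
  iterates exceed 1 in modulus on the ball.\<close>

lemma dominated_orbit_nearby:
  assumes hol: "f holomorphic_on UNIV" and esc: "uniformly_escaping f (ball w \<rho>)"
    and z: "dist w z \<le> \<rho> / 2" and \<rho>: "\<rho> > 0"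
  shows "dominated_orbit f z w"
proof -
  have "\<forall>\<^sub>F n in sequentially. \<forall>x\<in>ball w \<rho>. cmod ((f ^^ n) x) > 1"
    using esc unfolding uniformly_escaping_def by blast
  then have "\<forall>\<^sub>F n in sequentially. ln (cmod ((f ^^ n) z)) \<le> 3 * ln (cmod ((f ^^ n) w))"
    by eventually_elim
      (intro Harnack_ln_norm[OF holomorphic_on_subset[OF holomorphic_on_funpow[OF hol]] _ z \<rho>], auto)
  then show ?thesis unfolding dominated_orbit_def by (intro exI[of _ 3]) auto
qed

lemma dominated_orbit_component:
  assumes hol: "f holomorphic_on UNIV"
    and "connected \<Omega>" "open \<Omega>" "\<Omega> \<subseteq> locally_escaping_set f" "z \<in> \<Omega>" "w \<in> \<Omega>"
  shows "dominated_orbit f z w"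
proof -
  \<comment> \<open>Symmetrised, so that a locally valid equivalence relation spreads over the
    connected set.\<close>
  define R where "R = (\<lambda>z w. dominated_orbit f z w \<and> dominated_orbit f w z)"
  have "R z w"
  proof (rule connected_equivalence_relation[of \<Omega> z w R])
    fix a assume "a \<in> \<Omega>"
    then have "a \<in> locally_escaping_set f" using assms(4) by blast
    then obtain d where d: "d > 0" "uniformly_escaping f (ball a d)"
      by (rule locally_escaping_setE_ball)
    \<comment> \<open>Radius \<open>d / 3\<close> lets both centres be used: the disc of radius
      \<open>2 * d / 3\<close> about \<open>x\<close> stays in \<open>ball a d\<close>, and half of
      it still reaches \<open>a\<close>.\<close>
    have "R a x" if "x \<in> ball a (d / 3)" for x
    proof -
      have x: "dist a x < d / 3" using that by simp
      have "ball x (2 * d / 3) \<subseteq> ball a d"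
      proof
        fix y assume "y \<in> ball x (2 * d / 3)"
        then have "dist x y < 2 * d / 3" by simp
        with x have "dist a y < d" using dist_triangle[of a y x] by linarith
        then show "y \<in> ball a d" by simp
      qed
      then have "uniformly_escaping f (ball x (2 * d / 3))"
        using d(2) uniformly_escaping_subset by blast
      moreover have "dist x a \<le> (2 * d / 3) / 2" using x by (simp add: dist_commute)
      ultimately have "dominated_orbit f a x"
        using d(1) by (intro dominated_orbit_nearby[OF hol, where \<rho> = "2 * d / 3"]) simp_all
      moreover have "dominated_orbit f x a"
        using x d by (intro dominated_orbit_nearby[OF hol d(2)]) simp_all
      ultimately show ?thesis by (simp add: R_def)
    qed
    then show "\<exists>T. openin (top_of_set \<Omega>) T \<and> a \<in> T \<and> (\<forall>x\<in>T. R a x)"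
      using d(1) \<open>a \<in> \<Omega>\<close> by (intro exI[of _ "\<Omega> \<inter> ball a (d / 3)"]) auto
  next
    fix x y z assume "R x y" "R y z"
    then show "R x z" unfolding R_def using dominated_orbit_trans by blast
  qed (use assms(2,5,6) in \<open>simp_all add: R_def\<close>)
  then show ?thesis by (simp add: R_def)
qed

subsection \<open>Trapping in a sequence of annuli\<close>

text \<open>Only logarithmic data remain. The recursion \<open>r_rec\<close> says that
  \<open>r (Suc (Suc j)) / r (Suc j)\<close> is the power \<open>M (Suc j)\<close> of
  \<open>r (Suc j) / r j\<close>, and \<open>ln_norm_approx\<close> compares \<open>f\<close> with
  the power map. Its \<open>R\<close> is uniform in \<open>j\<close>, which permits one threshold
  for all annuli.\<close>

locale logarithmic_annuli =
  fixes M :: "nat \<Rightarrow> nat" and r :: "nat \<Rightarrow> real" and f :: "complex \<Rightarrow> complex"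
  assumes M_pos: "1 \<le> j \<Longrightarrow> 1 \<le> M j"
    and M_strict: "1 \<le> i \<Longrightarrow> i < j \<Longrightarrow> M i < M j"
    and r_pos: "1 \<le> j \<Longrightarrow> 0 < r j"
    and r_top: "filterlim r at_top sequentially"
    and r_sep: "1 \<le> j \<Longrightarrow> ln (r j) + pi / M j \<le> ln (r (Suc j))"
    and r_rec: "1 \<le> j \<Longrightarrow>
      ln (r (Suc (Suc j))) - ln (r (Suc j)) = real (M (Suc j)) * (ln (r (Suc j)) - ln (r j))"
    and hol: "f holomorphic_on UNIV"
    and zero_fixed: "f 0 = 0"
    and ln_norm_approx: "\<epsilon> > 0 \<Longrightarrow> \<exists>R. \<forall>j\<ge>1. \<forall>z. R \<le> cmod z \<longrightarrow>
      ln (r j) + \<epsilon> + pi / M j \<le> ln (cmod z) \<longrightarrow> ln (cmod z) \<le> ln (r (Suc j)) - \<epsilon> \<longrightarrow>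
      f z \<noteq> 0 \<and>
      \<bar>ln (cmod (f z)) - (ln (r (Suc (Suc j))) + real (M (Suc j)) * (ln (cmod z) - ln (r (Suc j))))\<bar>
        \<le> real (M (Suc j)) * \<epsilon>"
begin

text \<open>Indices are shifted: \<open>ann a j\<close> is \<open>A\<^sub>j\<^sub>+\<^sub>1\<close> of the statement, with \<open>\<alpha> = exp (- a)\<close>.\<close>
definition ann :: "real \<Rightarrow> nat \<Rightarrow> complex set" where
  "ann a j = {z. z \<noteq> 0 \<and> ln (r j) + a + pi / M j < ln (cmod z) \<and> ln (cmod z) < ln (r (Suc j)) - a}"

text \<open>
  Up to an error, \<open>f\<close> multiplies the logarithmic height \<open>ln \<bar>z\<bar> - ln (r j)\<close> above the inner radius
  by \<open>M (Suc j)\<close>. As \<open>M (Suc j) \<ge> 2\<close>, subtracting \<open>a / 2\<close> absorbs that error.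
\<close>
definition trapping :: "real \<Rightarrow> nat \<Rightarrow> bool" where
  "trapping a j \<longleftrightarrow> 0 \<le> ln (r j) \<and> 2 \<le> M j \<and> ann a j \<noteq> {} \<and>
     (\<forall>z\<in>ann a j. f z \<in> ann a (Suc j) \<and>
        real (M (Suc j)) * (ln (cmod z) - ln (r j) - a / 2) \<le> ln (cmod (f z)) - ln (r (Suc j)) - a / 2)"

section \<open>Annuli, exponents and logarithmic gaps\<close>

lemma mem_ann_iff:
  assumes j: "1 \<le> j"
  shows "z \<in> ann a j \<longleftrightarrow>
    exp a * r j * exp (pi / M j) < cmod z \<and> cmod z < exp (- a) * r (Suc j)"
proof -
  have pos: "0 < r j" "0 < r (Suc j)" using r_pos j by simp_all
  have inner: "exp a * r j * exp (pi / M j) = exp (ln (r j) + a + pi / M j)"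
    and outer: "exp (- a) * r (Suc j) = exp (ln (r (Suc j)) - a)"
    using pos by (simp_all add: exp_add exp_diff exp_minus field_simps)
  have lt: "x < ln (cmod z) \<longleftrightarrow> exp x < cmod z" "ln (cmod z) < x \<longleftrightarrow> cmod z < exp x" if "z \<noteq> 0" for x
    using that exp_less_cancel_iff[of x "ln (cmod z)"] exp_less_cancel_iff[of "ln (cmod z)" x] by simp_all
  have "z \<noteq> 0" if "exp x < cmod z" for x using that less_trans[OF exp_gt_zero] by fastforce
  then show ?thesis unfolding ann_def inner outer using lt by blast
qed

text \<open>The term \<open>z - 0\<close> matches the form of
  \<open>connected_annulus\<close>.\<close>

lemma ann_eq: "1 \<le> j \<Longrightarrow> ann a j =
    {z. exp a * r j * exp (pi / M j) < cmod (z - 0) \<and> cmod (z - 0) < exp (- a) * r (Suc j)}"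
  using mem_ann_iff by auto

lemma open_ann: "1 \<le> j \<Longrightarrow> open (ann a j)"
  unfolding ann_eq by (intro open_Collect_conj open_Collect_less continuous_intros)

lemma connected_ann: "1 \<le> j \<Longrightarrow> connected (ann a j)"
  unfolding ann_eq by (rule connected_annulus) simp

lemma filterlim_ln_r: "filterlim (\<lambda>j. ln (r j)) at_top sequentially"
  by (rule filterlim_compose[OF ln_at_top r_top])

lemma M_ge: "j \<le> M (Suc j)"
proof (induction j)
  case (Suc j)
  then show ?case using M_strict[of "Suc j" "Suc (Suc j)"] by simp
qed simp

lemma filterlim_M: "filterlim M at_top sequentially"
proof -
  have "filterlim (\<lambda>j. M (Suc j)) at_top sequentially"
    by (rule filterlim_at_top_mono[OF filterlim_ident]) (simp add: M_ge)
  then show ?thesis by (simp add: filterlim_sequentially_Suc)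
qed

text \<open>The separation \<open>pi / M j\<close> is multiplied by \<open>M (Suc j)\<close>, which
  exceeds \<open>M j\<close>.\<close>

lemma gap_ge:
  assumes j: "1 \<le> j"
  shows "pi \<le> ln (r (Suc (Suc j))) - ln (r (Suc j))"
proof -
  have "pi = real (M j) * (pi / M j)" using M_pos[OF j] by simp
  also have "\<dots> \<le> real (M (Suc j)) * (ln (r (Suc j)) - ln (r j))"
    using M_strict[OF j, of "Suc j"] r_sep[OF j] by (intro mult_mono) simp_all
  finally show ?thesis using r_rec[OF j] by simp
qed

lemma trapping_eventually:
  assumes a: "a > 0"
  obtains N where "N \<ge> 1" "\<And>j. N \<le> j \<Longrightarrow> trapping a j"
proof -
  \<comment> \<open>With error \<open>a / 4\<close>, half of the \<open>a / 2\<close> subtracted in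
    \<open>trapping\<close> is left over; multiplied by \<open>M (Suc j) \<ge> 2\<close> it pays for
    the \<open>a / 2\<close> on the image side.\<close>
  obtain R where R: "\<And>j z. \<lbrakk>1 \<le> j; R \<le> cmod z; ln (r j) + a / 4 + pi / M j \<le> ln (cmod z);
      ln (cmod z) \<le> ln (r (Suc j)) - a / 4\<rbrakk> \<Longrightarrow> f z \<noteq> 0 \<and>
      \<bar>ln (cmod (f z)) - (ln (r (Suc (Suc j))) + real (M (Suc j)) * (ln (cmod z) - ln (r (Suc j))))\<bar>
        \<le> real (M (Suc j)) * (a / 4)"
    using ln_norm_approx[of "a / 4"] a by auto
  \<comment> \<open>The bound \<open>3 \<le> j\<close> leaves two earlier positive indices for
    \<open>gap_ge\<close>; the last condition makes the gap at \<open>j\<close> wide enough for two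
    margins \<open>a\<close> and \<open>pi / M j\<close>.\<close>
  have "\<forall>\<^sub>F j in sequentially. 3 \<le> j \<and> R \<le> r j \<and> 0 \<le> ln (r j) \<and>
      2 \<le> M j \<and> 2 * a + pi < 2 * real (M (j - 1))"
  proof (intro eventually_conj eventually_ge_at_top)
    show "\<forall>\<^sub>F j in sequentially. R \<le> r j" "\<forall>\<^sub>F j in sequentially. 0 \<le> ln (r j)"
      "\<forall>\<^sub>F j in sequentially. 2 \<le> M j"
      using r_top filterlim_ln_r filterlim_M by (simp_all add: filterlim_at_top)
    have "filterlim (\<lambda>j. real (M j)) at_top sequentially"
      using filterlim_compose[OF filterlim_real_sequentially filterlim_M] .
    then have "\<forall>\<^sub>F j in sequentially. a + pi \<le> real (M j)" by (simp add: filterlim_at_top)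
    then have "\<forall>\<^sub>F j in sequentially. 2 * a + pi < 2 * real (M (Suc j - 1))"
    proof eventually_elim
      case (elim j)
      then show ?case using pi_gt_zero unfolding diff_Suc_1 by linarith
    qed
    then show "\<forall>\<^sub>F j in sequentially. 2 * a + pi < 2 * real (M (j - 1))"
      by (subst (asm) eventually_sequentially_Suc)
  qed
  then obtain N where N: "\<And>j. N \<le> j \<Longrightarrow> 3 \<le> j \<and> R \<le> r j \<and> 0 \<le> ln (r j) \<and>
      2 \<le> M j \<and> 2 * a + pi < 2 * real (M (j - 1))"
    unfolding eventually_sequentially by blast
  have "trapping a j" if "N \<le> j" for j
  proof -
    have j: "3 \<le> j" "R \<le> r j" "0 \<le> ln (r j)" "2 \<le> M j" "2 * a + pi < 2 * real (M (j - 1))"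
      using N[OF that] by auto
    obtain i where i: "j = Suc (Suc i)" "1 \<le> i"
      using j(1) by (metis One_nat_def Suc_le_D Suc_le_mono numeral_3_eq_3)
    have pos: "0 < r j" "0 < r (Suc j)" using r_pos j(1) by simp_all
    have M: "2 \<le> real (M j)" using j(4) by simp
    have M': "real (M j) + 1 \<le> real (M (Suc j))" using M_strict[of j "Suc j"] j(1) by simp
    define q where "q = pi / M j"
    have piM: "q < pi" "0 < q" using M pi_gt_zero by (simp_all add: q_def field_simps)
    have Mq: "real (M j) * q = pi" using M by (simp add: q_def)
    define q' where "q' = pi / M (Suc j)"
    have piM': "q' < pi" using M M' pi_gt_zero by (simp add: q'_def field_simps)
    \<comment> \<open>The previous gap is at least \<open>pi > 2\<close>, and the recursion
      multiplies it by \<open>M j\<close>, which exceeds \<open>M (j - 1)\<close>.\<close>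
    have gap: "2 * a + pi < ln (r (Suc j)) - ln (r j)"
    proof -
      have "2 * real (M (j - 1)) \<le> real (M j) * pi"
        using M_strict[of "Suc i" j] pi_gt3
        by (subst mult.commute, intro mult_mono) (simp_all add: i(1))
      also have "\<dots> \<le> real (M j) * (ln (r j) - ln (r (Suc i)))"
        using gap_ge[OF i(2)] by (intro mult_left_mono) (simp_all add: i(1))
      also have "\<dots> = ln (r (Suc j)) - ln (r j)" using r_rec[of "Suc i"] by (simp add: i(1))
      finally show ?thesis using j(5) by linarith
    qed
    have "ann a j \<noteq> {}"
    proof -
      \<comment> \<open>The logarithmic midpoint between the inner and outer radii before the
        margins \<open>a\<close> are removed.\<close>
      define x where "x = (ln (r j) + pi / M j + ln (r (Suc j))) / 2"
      have x: "ln (r j) + a + pi / M j < x" "x < ln (r (Suc j)) - a"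
        using gap piM unfolding x_def q_def[symmetric] by (simp_all add: field_simps)
      have "of_real (exp x) \<in> ann a j"
        unfolding ann_def using x by simp
      then show ?thesis by blast
    qed
    moreover have "f z \<in> ann a (Suc j) \<and>
        real (M (Suc j)) * (ln (cmod z) - ln (r j) - a / 2) \<le> ln (cmod (f z)) - ln (r (Suc j)) - a / 2"
      if z: "z \<in> ann a j" for z
    proof -
      define t where "t = ln (cmod z)"
      have t: "ln (r j) + a + q < t" "t < ln (r (Suc j)) - a" and z0: "z \<noteq> 0"
        using z by (auto simp: ann_def t_def q_def)
      have "ln (r j) < ln (cmod z)" using t(1) a piM(2) by (simp add: t_def)
      then have "R \<le> cmod z" using pos z0 j(2) by (subst (asm) ln_less_cancel_iff) auto
      have near: "ln (r j) + a / 4 + q \<le> t" "t \<le> ln (r (Suc j)) - a / 4" using t a by simp_all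
      have fz: "f z \<noteq> 0"
        and "\<bar>ln (cmod (f z)) - (ln (r (Suc (Suc j))) + real (M (Suc j)) * (t - ln (r (Suc j))))\<bar>
          \<le> real (M (Suc j)) * (a / 4)"
        using R[of j z] j(1) near \<open>R \<le> cmod z\<close> by (simp_all add: t_def q_def)
      then have up: "ln (cmod (f z)) \<le> ln (r (Suc (Suc j))) + real (M (Suc j)) * (t - ln (r (Suc j)) + a / 4)"
        and lo: "ln (r (Suc (Suc j))) + real (M (Suc j)) * (t - ln (r (Suc j)) - a / 4) \<le> ln (cmod (f z))"
        unfolding abs_le_iff by (simp_all add: algebra_simps)
      have rec: "ln (r (Suc (Suc j))) = ln (r (Suc j)) + real (M (Suc j)) * (ln (r (Suc j)) - ln (r j))"
        using r_rec[of j] j(1) by simp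
      have lo': "real (M (Suc j)) * (t - ln (r j) - a / 4) \<le> ln (cmod (f z)) - ln (r (Suc j))"
        using lo unfolding rec by (simp add: algebra_simps)
      have "a / 2 \<le> real (M (Suc j)) * (a / 4)"
        using mult_right_mono[of 2 "real (M (Suc j))" "a / 4"] M M' a by simp
      then have growth: "real (M (Suc j)) * (t - ln (r j) - a / 2) \<le> ln (cmod (f z)) - ln (r (Suc j)) - a / 2"
        using lo' by (simp add: algebra_simps)
      \<comment> \<open>Inner side: the margin \<open>a * 3 / 4\<close> grows past \<open>a\<close>,
        while \<open>q\<close> grows to at least \<open>M j * q = pi\<close>, which exceeds the next
        \<open>q'\<close>.\<close>
      have "a + pi \<le> real (M (Suc j)) * (t - ln (r j) - a / 4)"
      proof -
        have "a + pi \<le> real (M (Suc j)) * (a * 3 / 4) + real (M j) * q"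
          using mult_right_mono[of 2 "real (M (Suc j))" "a * 3 / 4"] M M' a Mq by simp
        also have "\<dots> \<le> real (M (Suc j)) * (a * 3 / 4) + real (M (Suc j)) * q"
          using M' piM(2) by (intro add_left_mono mult_right_mono) auto
        also have "\<dots> = real (M (Suc j)) * (a * 3 / 4 + q)" by (simp add: distrib_left)
        also have "\<dots> \<le> real (M (Suc j)) * (t - ln (r j) - a / 4)"
          using t(1) by (intro mult_left_mono) auto
        finally show ?thesis .
      qed
      then have "ln (r (Suc j)) + a + q' < ln (cmod (f z))" using lo' piM' by linarith
      moreover have "real (M (Suc j)) * (t - ln (r (Suc j)) + a / 4) < - a"
      proof -
        have "real (M (Suc j)) * (t - ln (r (Suc j)) + a / 4) \<le> real (M (Suc j)) * (- (a * 3 / 4))"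
          using t(2) by (intro mult_left_mono) auto
        also have "\<dots> < - a"
          using mult_right_mono[of 2 "real (M (Suc j))" "a * 3 / 4"] M M' a by simp
        finally show ?thesis .
      qed
      then have "ln (cmod (f z)) < ln (r (Suc (Suc j))) - a" using up by linarith
      ultimately show ?thesis using growth fz by (simp add: ann_def t_def q'_def)
    qed
    ultimately show ?thesis using j by (simp add: trapping_def)
  qed
  then show thesis using that[of "max N 1"] by simp
qed

section \<open>Orbits of trapped annuli and separation of their components\<close>

context
  fixes a :: real and N :: nat
  assumes a: "a > 0" and N: "N \<ge> 1" and trap: "\<And>j. N \<le> j \<Longrightarrow> trapping a j"
begin

text \<open>The exponent of the model for \<open>f ^^ n\<close> on \<open>ann a j\<close>, namely
  the product of \<open>M (Suc j)\<close>, ..., \<open>M (j + n)\<close>.\<close>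

definition growth :: "nat \<Rightarrow> nat \<Rightarrow> real" where
  "growth j n = (\<Prod>i<n. real (M (Suc j + i)))"

lemma growth_0 [simp]: "growth j 0 = 1"
  and growth_Suc: "growth j (Suc n) = growth j n * M (Suc (j + n))"
  by (simp_all add: growth_def)

text \<open>Splitting off the first factor rather than the last shows that
  \<open>growth (Suc j) n / growth j n\<close> equals
  \<open>M (Suc (j + n)) / M (Suc j)\<close>.\<close>

lemma growth_Suc_shift: "growth j (Suc n) = real (M (Suc j)) * growth (Suc j) n"
  unfolding growth_def by (simp add: prod.lessThan_Suc_shift del: prod.lessThan_Suc)

lemma growth_pos: "growth j n > 0"
  unfolding growth_def using M_pos[of "Suc j + i" for i] by (intro prod_pos) (simp add: Suc_le_eq)

lemma growth_mono: "j \<le> k \<Longrightarrow> growth j n \<le> growth k n"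
  unfolding growth_def
proof (intro prod_mono conjI)
  fix i assume "j \<le> k"
  then show "real (M (Suc j + i)) \<le> real (M (Suc k + i))"
    using M_strict[of "Suc j + i" "Suc k + i"] by (cases "j = k") auto
qed simp

lemma orbit_mem_ann: "N \<le> j \<Longrightarrow> z \<in> ann a j \<Longrightarrow> (f ^^ n) z \<in> ann a (j + n)"
proof (induction n)
  case (Suc n)
  then show ?case using trap[of "j + n"] by (simp add: trapping_def)
qed simp

lemma uniformly_escaping_ann:
  assumes "N \<le> j"
  shows "uniformly_escaping f (ann a j)"
  unfolding uniformly_escaping_def
proof
  fix B
  have "\<forall>\<^sub>F n in sequentially. B < r (n + j)"
    using r_top by (subst eventually_sequentially_seg) (simp add: filterlim_at_top_dense)
  then show "\<forall>\<^sub>F n in sequentially. \<forall>z\<in>ann a j. B < cmod ((f ^^ n) z)"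
  proof eventually_elim
    case (elim n)
    show ?case
    proof
      fix z assume "z \<in> ann a j"
      then have "(f ^^ n) z \<in> ann a (j + n)" using assms by (intro orbit_mem_ann)
      then have nz: "(f ^^ n) z \<noteq> 0"
        and "ln (r (j + n)) + a + pi / M (j + n) < ln (cmod ((f ^^ n) z))"
        by (auto simp: ann_def)
      moreover have "0 \<le> pi / M (j + n)" by simp
      ultimately have "ln (r (j + n)) < ln (cmod ((f ^^ n) z))" using a by linarith
      then have "r (j + n) < cmod ((f ^^ n) z)"
        using r_pos[of "j + n"] assms N nz by simp
      with elim show "B < cmod ((f ^^ n) z)" by (simp add: add.commute)
    qed
  qed
qed

lemma ann_subset_locally_escaping_set: "N \<le> j \<Longrightarrow> ann a j \<subseteq> locally_escaping_set f"
  unfolding locally_escaping_set_def using uniformly_escaping_ann open_ann N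
  by (intro Union_upper) simp

text \<open>The inequality in \<open>trapping\<close> iterates exactly, starting from a height that
  exceeds \<open>a / 2\<close> by at least \<open>a / 2\<close>.\<close>

lemma orbit_lower_bound:
  assumes "N \<le> j" "z \<in> ann a j"
  shows "a / 2 * growth j n \<le> ln (cmod ((f ^^ n) z))"
proof -
  have "growth j n * (ln (cmod z) - ln (r j) - a / 2) \<le> ln (cmod ((f ^^ n) z)) - ln (r (j + n)) - a / 2"
  proof (induction n)
    case (Suc n)
    have "growth j (Suc n) * (ln (cmod z) - ln (r j) - a / 2)
        = real (M (Suc (j + n))) * (growth j n * (ln (cmod z) - ln (r j) - a / 2))"
      by (simp add: growth_Suc)
    also have "\<dots> \<le> real (M (Suc (j + n))) * (ln (cmod ((f ^^ n) z)) - ln (r (j + n)) - a / 2)"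
      by (rule mult_left_mono[OF Suc]) simp
    also have "\<dots> \<le> ln (cmod ((f ^^ Suc n) z)) - ln (r (j + Suc n)) - a / 2"
      using trap[of "j + n"] orbit_mem_ann[OF assms] assms(1) by (simp add: trapping_def)
    finally show ?case .
  qed simp
  moreover have "growth j n * (a / 2) \<le> growth j n * (ln (cmod z) - ln (r j) - a / 2)"
  proof (rule mult_left_mono)
    have "ln (r j) + a + pi / M j < ln (cmod z)" using assms(2) by (simp add: ann_def)
    moreover have "0 \<le> pi / M j" by simp
    ultimately show "a / 2 \<le> ln (cmod z) - ln (r j) - a / 2" by linarith
  qed (use growth_pos[of j n] in simp)
  moreover have "0 \<le> ln (r (j + n))" using trap[of "j + n"] assms(1) by (simp add: trapping_def)
  ultimately show ?thesis using a by (simp add: mult.commute)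
qed

text \<open>The gaps equal \<open>growth j n\<close> times the first gap and \<open>growth\<close>
  at least doubles, so their sum is controlled by the last one. Half of \<open>K\<close> absorbs the
  earlier bound, the other half the new gap.\<close>

lemma ln_r_upper_bound:
  assumes "N \<le> j"
  defines "K \<equiv> ln (r (Suc j)) + 2 * (ln (r (Suc j)) - ln (r j))"
  shows "ln (r (Suc (j + n))) \<le> K * growth j n"
proof -
  define L where "L = ln (r (Suc j)) - ln (r j)"
  have j: "1 \<le> j" using assms(1) N by simp
  have "0 \<le> pi / M j" by simp
  then have L: "0 \<le> L" using r_sep[OF j] unfolding L_def by linarith
  have K: "2 * L \<le> K" "0 \<le> K"
    using trap[of "Suc j"] assms(1) L by (auto simp: K_def L_def trapping_def)
  have gap: "ln (r (Suc (j + n))) - ln (r (j + n)) = growth j n * L" for n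
  proof (induction n)
    case (Suc n)
    then show ?case using r_rec[of "j + n"] j by (simp add: growth_Suc)
  qed (simp add: L_def)
  show ?thesis
  proof (induction n)
    case 0
    then show ?case using L by (simp add: K_def L_def)
  next
    case (Suc n)
    have "real 2 * growth j n \<le> growth j (Suc n)"
      using trap[of "Suc (j + n)"] assms(1) growth_pos[of j n]
      by (subst growth_Suc, subst mult.commute, intro mult_left_mono) (auto simp: trapping_def)
    then have "K / 2 * (2 * growth j n) \<le> K / 2 * growth j (Suc n)"
      using K(2) by (intro mult_left_mono) auto
    moreover have "growth j (Suc n) * L \<le> growth j (Suc n) * (K / 2)"
      using K(1) growth_pos[of j "Suc n"] by (intro mult_left_mono) auto
    ultimately have "ln (r (Suc (j + n))) + growth j (Suc n) * L \<le> K * growth j (Suc n)"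
      using Suc by (simp add: algebra_simps)
    then show ?case using gap[of "Suc n"] by simp
  qed
qed

text \<open>Domination would bound \<open>growth k n\<close>, hence \<open>growth (Suc j) n\<close>,
  by a multiple of \<open>growth j n\<close>; cancelling bounds \<open>M (Suc (j + n))\<close> by
  the constant \<open>D\<close>.\<close>

lemma not_dominated_orbit:
  assumes "N \<le> j" "j < k" and w: "w \<in> ann a j" and z: "z \<in> ann a k"
  shows "\<not> dominated_orbit f z w"
proof
  define K where "K = ln (r (Suc j)) + 2 * (ln (r (Suc j)) - ln (r j))"
  assume "dominated_orbit f z w"
  then obtain C where C: "C > 0"
    "\<forall>\<^sub>F n in sequentially. ln (cmod ((f ^^ n) z)) \<le> C * ln (cmod ((f ^^ n) w))"
    unfolding dominated_orbit_def by blast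
  define D where "D = C * K * M (Suc j) / (a / 2)"
  have "\<forall>\<^sub>F n in sequentially. real (M (Suc (j + n))) \<le> D"
    using C(2)
  proof eventually_elim
    case (elim n)
    have "(f ^^ n) w \<in> ann a (j + n)" using assms(1) w by (rule orbit_mem_ann)
    then have "ln (cmod ((f ^^ n) w)) \<le> ln (r (Suc (j + n)))" using a by (auto simp: ann_def)
    also have "\<dots> \<le> K * growth j n" unfolding K_def by (rule ln_r_upper_bound[OF assms(1)])
    finally have "C * ln (cmod ((f ^^ n) w)) \<le> C * (K * growth j n)" using C(1) by simp
    moreover have "a / 2 * growth k n \<le> ln (cmod ((f ^^ n) z))"
      using assms(1,2) z by (intro orbit_lower_bound) auto
    moreover have "a / 2 * growth (Suc j) n \<le> a / 2 * growth k n"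
      using a assms(2) by (intro mult_left_mono growth_mono) auto
    ultimately have "a / 2 * growth (Suc j) n \<le> C * (K * growth j n)" using elim by linarith
    then have "real (M (Suc j)) * (a / 2 * growth (Suc j) n) \<le> real (M (Suc j)) * (C * (K * growth j n))"
      by (rule mult_left_mono) simp
    moreover have "real (M (Suc j)) * growth (Suc j) n = growth j n * M (Suc (j + n))"
      using growth_Suc_shift[of j n] growth_Suc[of j n] by simp
    ultimately have "growth j n * (a / 2 * M (Suc (j + n))) \<le> growth j n * (C * K * M (Suc j))"
      by (simp add: mult_ac)
    then have "a / 2 * M (Suc (j + n)) \<le> C * K * M (Suc j)"
      using growth_pos[of j n] by simp
    then show ?case using a by (simp add: D_def field_simps)
  qed
  moreover have "\<forall>\<^sub>F n in sequentially. D < real n"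
    using filterlim_real_sequentially by (simp add: filterlim_at_top_dense)
  ultimately have "\<forall>\<^sub>F n in sequentially. False"
  proof eventually_elim
    case (elim n)
    have "real n \<le> real (M (Suc (j + n)))" using M_ge[of "j + n"] by simp
    with elim show ?case by simp
  qed
  then show False by simp
qed

lemma zero_not_escaping: "0 \<notin> locally_escaping_set f"
proof
  assume "0 \<in> locally_escaping_set f"
  then have "\<forall>\<^sub>F n in sequentially. 1 < cmod ((f ^^ n) 0)" by (rule eventually_norm_gt_if_escaping)
  moreover have "(f ^^ n) 0 = 0" for n by (induction n) (simp_all add: zero_fixed)
  ultimately show False by simp
qed

section \<open>The wandering components and their topology\<close>

lemma ann_subset_wandering_domain:
  assumes j: "N \<le> j"
  shows "\<exists>\<Omega>. wandering_domain f \<Omega> \<and> \<not> simply_connected \<Omega> \<and> ann a j \<subseteq> \<Omega>"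
proof -
  let ?E = "locally_escaping_set f"
  define p where "p = (\<lambda>k. SOME x. x \<in> ann a k)"
  define W where "W = (\<lambda>k. connected_component_set (Fatou_set f) (p k))"
  have p: "p k \<in> ann a k" if "N \<le> k" for k
    using trap[OF that] by (simp add: p_def trapping_def some_in_eq)
  have ann_Fatou: "ann a k \<subseteq> Fatou_set f" if "N \<le> k" for k
    using ann_subset_locally_escaping_set[OF that] locally_escaping_set_subset_Fatou_set
    by (rule order_trans)
  have W_comp: "W k \<in> components (Fatou_set f)" if "N \<le> k" for k
    unfolding W_def using subsetD[OF ann_Fatou p] that by (intro componentsI)
  have W_ann: "ann a k \<subseteq> W k" if "N \<le> k" for k
    unfolding W_def using p connected_ann ann_Fatou N that by (intro connected_component_maximal) simp_all
  have W_esc: "W k \<subseteq> ?E" if k: "N \<le> k" for k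
    using Fatou_component_subset_locally_escaping_set[OF W_comp[OF k]
        subsetD[OF W_ann[OF k] p[OF k]] subsetD[OF ann_subset_locally_escaping_set[OF k] p[OF k]]] .
  have W_neq: "W i \<noteq> W k" if ik: "N \<le> i" "i < k" for i k
  proof
    assume eq: "W i = W k"
    have k: "N \<le> k" using ik by simp
    have "p k \<in> W i" using subsetD[OF W_ann[OF k] p[OF k]] eq by simp
    then have "dominated_orbit f (p k) (p i)"
      by (intro dominated_orbit_component[OF hol in_components_connected[OF W_comp[OF ik(1)]]
          open_components[OF open_Fatou_set W_comp[OF ik(1)]] W_esc[OF ik(1)]]
          subsetD[OF W_ann[OF ik(1)] p[OF ik(1)]])
    then show False using not_dominated_orbit[OF ik p[OF ik(1)] p[OF k]] by contradiction
  qed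
  have "inj (\<lambda>n. W (j + n))"
  proof (rule injI)
    fix m n assume "W (j + m) = W (j + n)"
    then show "m = n"
      using W_neq[of "j + m" "j + n"] W_neq[of "j + n" "j + m"] j by (cases m n rule: linorder_cases) auto
  qed
  moreover have "(f ^^ n) ` W j \<subseteq> W (j + n)" for n
  proof -
    \<comment> \<open>Invariance of the escaping set keeps the images in the Fatou set; being
      connected and meeting \<open>W (j + n)\<close> along the orbit of \<open>p j\<close>, they lie
      in that component.\<close>
    have "(f ^^ n) ` W j \<subseteq> ?E"
    proof (induction n)
      case (Suc n)
      have "(f ^^ Suc n) ` W j = f ` (f ^^ n) ` W j" by (simp add: image_comp)
      with Suc show ?case using image_locally_escaping_set[OF hol] by blast
    qed (use W_esc[OF j] in simp)
    then have "(f ^^ n) ` W j \<subseteq> Fatou_set f" using locally_escaping_set_subset_Fatou_set by blast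
    moreover have "connected ((f ^^ n) ` W j)"
      by (intro connected_continuous_image in_components_connected[OF W_comp[OF j]]
          holomorphic_on_imp_continuous_on holomorphic_on_subset[OF holomorphic_on_funpow[OF hol]]) simp
    moreover have "W (j + n) \<inter> (f ^^ n) ` W j \<noteq> {}"
    proof -
      have "(f ^^ n) (p j) \<in> W (j + n)"
        using orbit_mem_ann[OF j p[OF j]] W_ann[of "j + n"] j by auto
      then show ?thesis using subsetD[OF W_ann[OF j] p[OF j]] by blast
    qed
    ultimately show ?thesis
      using j by (intro components_maximal[OF W_comp]) simp_all
  qed
  ultimately have "wandering_domain f (W j)"
    unfolding wandering_domain_def using W_comp j
    by (intro conjI exI[of _ "\<lambda>n. W (j + n)"] allI) simp_all
  moreover have "\<not> simply_connected (W j)"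
  proof
    assume sc: "simply_connected (W j)"
    define \<rho> where "\<rho> = cmod (p j)"
    have \<rho>: "\<rho> > 0" using p[OF j] by (simp add: \<rho>_def ann_def)
    \<comment> \<open>Membership in the annulus depends only on the modulus, so the whole circle
      through \<open>p j\<close> lies in it. It winds once around 0, which is outside
      \<open>W j\<close>.\<close>
    have "path_image (circlepath 0 \<rho>) \<subseteq> ann a j"
      using p[OF j] \<rho> by (auto simp: ann_def \<rho>_def path_image_circlepath)
    then have "winding_number (circlepath 0 \<rho>) 0 = 0"
      using W_ann[OF j] W_esc[OF j] zero_not_escaping
      by (intro simply_connected_imp_winding_number_zero[OF sc]) auto
    then show False using winding_number_circlepath_centre[OF \<rho>, of 0] by simp
  qed
  ultimately show ?thesis using W_ann[OF j] by blast
qed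

end

end

subsection \<open>Interpolated power maps\<close>

theorem theorem5p5:
  fixes M :: "nat \<Rightarrow> nat" and r :: "nat \<Rightarrow> real" and c :: complex
    and f :: "complex \<Rightarrow> complex"
  assumes "strongly_permissible M r"
    and "M 0 = 1" and "r 0 = 0"
    and "c \<noteq> 0"
    and "\<forall>j\<ge>1. complex_of_real (r (j + 1)) = power_coeff M r c j * complex_of_real (r j) ^ M j"
    and "associated_entire_function M r c f"
  shows "\<forall>\<alpha>::real. 0 < \<alpha> \<and> \<alpha> < 1 \<longrightarrow>
           (\<exists>N\<ge>1. \<forall>j\<ge>N. \<exists>\<Omega>. wandering_domain f \<Omega> \<and> \<not> simply_connected \<Omega> \<and>
              annulus M r \<alpha> j \<subseteq> \<Omega>)"
proof -
  let ?c = "power_coeff M r c"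
  have M_pos: "1 \<le> M j" and r_pos: "0 < r j" if "1 \<le> j" for j
    using assms(1) that by (auto simp: strongly_permissible_def)
  have M_strict: "M i < M j" if "1 \<le> i" "i < j" for i j
    using assms(1) that by (auto simp: strongly_permissible_def strict_mono_on_def)
  have r_top: "filterlim r at_top sequentially"
    using assms(1) by (simp add: strongly_permissible_def)
  have r_sep: "ln (r j) + pi / M j \<le> ln (r (Suc j))" if j: "1 \<le> j" for j
  proof -
    have "exp (pi / M j) * r j \<le> r (Suc j)"
      using assms(1) j by (simp add: strongly_permissible_def)
    then have "ln (exp (pi / M j) * r j) \<le> ln (r (Suc j))"
      using r_pos[OF j] by (intro ln_mono) auto
    then show ?thesis using r_pos[OF j] by (simp add: ln_mult_pos)
  qed
  have r_Suc: "r (Suc j) = cmod (?c j) * r j ^ M j" if j: "1 \<le> j" for j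
  proof -
    have "cmod (of_real (r (Suc j))) = cmod (?c j * of_real (r j) ^ M j)"
      using assms(5) j by simp
    then show ?thesis using r_pos[of j] r_pos[of "Suc j"] j by (simp add: norm_mult norm_power)
  qed
  have c_nz: "?c j \<noteq> 0" if "1 \<le> j" for j
    using r_Suc[OF that] r_pos[of "Suc j"] by auto
  have ln_c: "ln (cmod (?c j)) = ln (r (Suc j)) - real (M j) * ln (r j)" if j: "1 \<le> j" for j
    using c_nz[OF j] r_pos[OF j] by (simp add: r_Suc[OF j] ln_mult_pos ln_realpow)
  have r_rec: "ln (r (Suc (Suc j))) - ln (r (Suc j)) = real (M (Suc j)) * (ln (r (Suc j)) - ln (r j))"
    if j: "1 \<le> j" for j
  proof -
    obtain i where i: "j = Suc i" using j by (cases j) auto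
    have "M j < M (Suc j)" using M_strict j by simp
    \<comment> \<open>The integer exponent is negative, so the power becomes the inverse of a
      natural power.\<close>
    then have diff: "int (M j) - int (M (Suc j)) = - int (M (Suc j) - M j)" by simp
    have "?c (Suc j) = ?c j * of_real (r j) powi (int (M j) - int (M (Suc j)))"
      by (simp only: i power_coeff.simps)
    then have "cmod (?c (Suc j)) = cmod (?c j) * inverse (r j ^ (M (Suc j) - M j))"
      unfolding diff using r_pos[OF j]
      by (simp only: norm_mult norm_inverse norm_power norm_of_real abs_of_pos power_int_minus power_int_of_nat)
    then have "ln (cmod (?c (Suc j))) = ln (cmod (?c j)) - real (M (Suc j) - M j) * ln (r j)"
      using c_nz[OF j] r_pos[OF j] by (simp add: ln_mult_pos ln_inverse ln_realpow)
    then show ?thesis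
      using ln_c[OF j] ln_c[of "Suc j"] \<open>M j < M (Suc j)\<close> by (simp add: of_nat_diff algebra_simps)
  qed
  have hol: "f holomorphic_on UNIV" using assms(6) by (simp add: associated_entire_function_def)
  obtain \<phi> where qc: "quasiconformal \<phi>" and \<phi>0: "\<phi> 0 = 0"
    and \<phi>_lim: "((\<lambda>z. cmod (\<phi> z / z - 1)) \<longlongrightarrow> 0) at_infinity"
    and f_\<phi>: "\<And>j z. \<lbrakk>1 \<le> j; r (j - 1) * exp (pi / real (M (j - 1))) \<le> cmod z; cmod z \<le> r j\<rbrakk>
      \<Longrightarrow> f (\<phi> z) = ?c j * z ^ M j"
    using assms(6) unfolding associated_entire_function_def by blast
  obtain \<psi> where homeo: "homeomorphism UNIV UNIV \<phi> \<psi>"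
    using qc by (auto simp: quasiconformal_def)
  then have \<phi>\<psi>: "\<phi> (\<psi> z) = z" for z by (simp add: homeomorphism_def)
  have cont: "continuous_on UNIV \<phi>" using homeo by (simp add: homeomorphism_def)
  \<comment> \<open>The convention \<open>r 0 = 0\<close> makes the first power formula valid at the
    origin, which \<open>\<phi>\<close> fixes.\<close>
  have f0: "f 0 = 0"
    using f_\<phi>[of 1 0] \<phi>0 assms(3) r_pos[of 1] M_pos[of 1] by (simp add: power_0_left)
  have \<psi>_approx: "\<exists>R. \<forall>z. R \<le> cmod z \<longrightarrow> z \<noteq> 0 \<and> \<psi> z \<noteq> 0 \<and> \<bar>ln (cmod (\<psi> z)) - ln (cmod z)\<bar> \<le> \<epsilon>"
    if \<epsilon>: "\<epsilon> > 0" for \<epsilon>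
  proof -
    have "((\<lambda>z. \<phi> z / z - 1) \<longlongrightarrow> 0) at_infinity" using \<phi>_lim by (rule tendsto_norm_zero_cancel)
    then have "((\<lambda>z. \<phi> z / z) \<longlongrightarrow> 1) at_infinity" by (simp only: LIM_zero_iff)
    then have "((\<lambda>z. ln (cmod (\<phi> z / z))) \<longlongrightarrow> ln (cmod 1)) at_infinity"
      by (intro tendsto_intros) simp_all
    then have "\<forall>\<^sub>F z in at_infinity. \<bar>ln (cmod (\<phi> z / z))\<bar> < \<epsilon>"
      using tendstoD[OF _ \<epsilon>] by (fastforce simp: dist_real_def)
    then obtain B where B: "\<And>\<zeta>. B \<le> cmod \<zeta> \<Longrightarrow> \<bar>ln (cmod (\<phi> \<zeta> / \<zeta>))\<bar> < \<epsilon>"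
      by (auto simp: eventually_at_infinity)
    \<comment> \<open>Boundedness of \<open>\<phi>\<close> on this disc forces
      \<open>\<psi> z\<close> out of it when \<open>z\<close> is large; \<open>max B 0\<close> also
      ensures \<open>\<psi> z \<noteq> 0\<close>.\<close>
    have "bounded (\<phi> ` cball 0 (max B 0))"
      by (intro compact_imp_bounded compact_continuous_image continuous_on_subset[OF cont]) auto
    then obtain R where R: "R > 0" "\<And>\<zeta>. cmod \<zeta> \<le> max B 0 \<Longrightarrow> cmod (\<phi> \<zeta>) \<le> R"
      by (auto simp: bounded_pos)
    have "z \<noteq> 0 \<and> \<psi> z \<noteq> 0 \<and> \<bar>ln (cmod (\<psi> z)) - ln (cmod z)\<bar> \<le> \<epsilon>" if z: "R + 1 \<le> cmod z" for z
    proof -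
      have "\<not> cmod (\<psi> z) \<le> max B 0" using R(2)[of "\<psi> z"] z by (auto simp: \<phi>\<psi>)
      then have "B \<le> cmod (\<psi> z)" "\<psi> z \<noteq> 0" by auto
      moreover have "z \<noteq> 0" using z R(1) by auto
      moreover from calculation have "ln (cmod (\<phi> (\<psi> z) / \<psi> z)) = ln (cmod z) - ln (cmod (\<psi> z))"
        by (simp add: \<phi>\<psi> norm_divide ln_div)
      ultimately show ?thesis using B[of "\<psi> z"] by auto
    qed
    then show ?thesis by blast
  qed
  have approx: "\<exists>R. \<forall>j\<ge>1. \<forall>z. R \<le> cmod z \<longrightarrow>
      ln (r j) + \<epsilon> + pi / M j \<le> ln (cmod z) \<longrightarrow> ln (cmod z) \<le> ln (r (Suc j)) - \<epsilon> \<longrightarrow>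
      f z \<noteq> 0 \<and>
      \<bar>ln (cmod (f z)) - (ln (r (Suc (Suc j))) + real (M (Suc j)) * (ln (cmod z) - ln (r (Suc j))))\<bar>
        \<le> real (M (Suc j)) * \<epsilon>" if \<epsilon>: "\<epsilon> > 0" for \<epsilon>
  proof -
    obtain R where R: "\<And>z. R \<le> cmod z \<Longrightarrow>
        z \<noteq> 0 \<and> \<psi> z \<noteq> 0 \<and> \<bar>ln (cmod (\<psi> z)) - ln (cmod z)\<bar> \<le> \<epsilon>"
      using \<psi>_approx[OF \<epsilon>] by blast
    have "f z \<noteq> 0 \<and>
      \<bar>ln (cmod (f z)) - (ln (r (Suc (Suc j))) + real (M (Suc j)) * (ln (cmod z) - ln (r (Suc j))))\<bar>
        \<le> real (M (Suc j)) * \<epsilon>"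
      if j: "1 \<le> j" and z: "R \<le> cmod z" "ln (r j) + \<epsilon> + pi / M j \<le> ln (cmod z)"
        "ln (cmod z) \<le> ln (r (Suc j)) - \<epsilon>" for j z
    proof -
      define \<zeta> where "\<zeta> = \<psi> z"
      have \<zeta>: "\<zeta> \<noteq> 0" "\<bar>ln (cmod \<zeta>) - ln (cmod z)\<bar> \<le> \<epsilon>" using R[OF z(1)] by (simp_all add: \<zeta>_def)
      \<comment> \<open>The margin \<open>\<epsilon>\<close> around \<open>z\<close> pays for the
        displacement by \<open>\<psi>\<close>, so \<open>\<zeta>\<close> lies where the power
        formula holds.\<close>
      have "ln (r j * exp (pi / M j)) \<le> ln (cmod \<zeta>)" "ln (cmod \<zeta>) \<le> ln (r (Suc j))"
        using z(2,3) \<zeta>(2) r_pos[OF j] by (auto simp: ln_mult_pos)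
      then have "r j * exp (pi / M j) \<le> cmod \<zeta>" "cmod \<zeta> \<le> r (Suc j)"
        using r_pos[OF j] r_pos[of "Suc j"] \<zeta>(1) by (simp_all add: ln_le_cancel_iff)
      then have fz: "f z = ?c (Suc j) * \<zeta> ^ M (Suc j)"
        using f_\<phi>[of "Suc j" \<zeta>] by (simp add: \<zeta>_def \<phi>\<psi>)
      have nz: "?c (Suc j) \<noteq> 0" using c_nz by simp
      have "ln (cmod (f z)) = ln (cmod (?c (Suc j))) + real (M (Suc j)) * ln (cmod \<zeta>)"
        unfolding fz using nz \<zeta>(1) by (simp add: norm_mult norm_power ln_mult_pos ln_realpow)
      \<comment> \<open>By \<open>ln_c\<close>, the whole error is the logarithmic displacement of
        \<open>\<psi>\<close>, magnified by the exponent.\<close>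
      then have "ln (cmod (f z)) - (ln (r (Suc (Suc j))) + real (M (Suc j)) * (ln (cmod z) - ln (r (Suc j))))
          = real (M (Suc j)) * (ln (cmod \<zeta>) - ln (cmod z))"
        using ln_c[of "Suc j"] by (simp add: algebra_simps)
      then show ?thesis using \<zeta> nz by (simp add: fz abs_mult mult_left_mono)
    qed
    then show ?thesis by blast
  qed
  interpret logarithmic_annuli M r f
    by unfold_locales (use M_pos M_strict r_pos r_top r_sep r_rec hol f0 approx in blast)+
  show ?thesis
  proof (intro allI impI)
    fix \<alpha> :: real assume \<alpha>: "0 < \<alpha> \<and> \<alpha> < 1"
    define a where "a = - ln \<alpha>"
    have a: "a > 0" "exp a = inverse \<alpha>" "exp (- a) = \<alpha>"
      using \<alpha> by (simp_all add: a_def exp_minus)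
    obtain N where N: "N \<ge> 1" "\<And>j. N \<le> j \<Longrightarrow> trapping a j"
      using trapping_eventually[OF a(1)] by blast
    \<comment> \<open>The index shift between the two families of annuli turns the threshold
      \<open>N\<close> into \<open>Suc N\<close>.\<close>
    have "annulus M r \<alpha> (Suc j) = ann a j" if "N \<le> j" for j
      using that N(1) by (auto simp: annulus_def mem_ann_iff a)
    then have "\<exists>\<Omega>. wandering_domain f \<Omega> \<and> \<not> simply_connected \<Omega> \<and> annulus M r \<alpha> j \<subseteq> \<Omega>"
      if "Suc N \<le> j" for j
      using ann_subset_wandering_domain[OF a(1) N, of "j - 1"] that by (cases j) auto
    then show "\<exists>N\<ge>1. \<forall>j\<ge>N. \<exists>\<Omega>. wandering_domain f \<Omega> \<and> \<not> simply_connected \<Omega> \<and>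
        annulus M r \<alpha> j \<subseteq> \<Omega>"
      by (intro exI[of _ "Suc N"]) auto
  qed
qed

end
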